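(* Let $H$ be a finite hypergraph with positive functions $\delta_{V(H)}:V(H)\to(0,\infty)$ and $\delta_{E(H)}:E(H)\to(0,\infty)$, and let $U$ be a subset of $V(H)$ with $|U|>1$. If $U$ is a maximal subset (with respect to inclusion) such that $S_U$ is a subspace of the eigenspace of the eigenvalue $0$ of $Q_{(H,\delta_{V(H)},\delta_{E(H)})}$, then $U$ is a unit of $H$.
   Context: A (finite) hypergraph $H$ is a pair $(V(H),E(H))$, where $V(H)$ is a non-empty finite set and $E(H)$ is a collection of non-empty subsets of $V(H)$. For $v\in V(H)$ the star is $E_v(H)=\{e\in E(H):v\in e\}$. The relation $\mathfrak{R}_s=\{(u,v)\in V(H)\times V(H):E_u(H)=E_v(H)\}$ is an equivalence relation on $V(H)$; its equivalence classes are called units. The general signless Laplacian $Q_{(H,\delta_{V(H)},\delta_{E(H)})}:\mathbb{C}^{V(H)}\to\mathbb{C}^{V(H)}$ is $$(Q_{(H,\delta_{V(H)},\delta_{E(H)})}x)(v)=\sum_{e\in E_v(H)}\frac{\delta_{E(H)}(e)}{\delta_{V(H)}(v)}\frac{1}{|e|^2}\sum_{u\in e}x(u).$$ For $U\subseteq V(H)$, $S_U=\{x\in\mathbb{C}^{V(H)}: \{v: x(v)\neq 0\}\subseteq U,\ \sum_{v\in U}x(v)=0\}$. *)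

theory Defs
  imports Complex_Main "HOL-Library.Function_Algebras"
begin

locale finite_hypergraph =
  fixes V :: "'a set" and E :: "'a set set"
  assumes finite_verts: "finite V"
    and verts_nonempty: "V \<noteq> {}"
    and edges_subset: "e \<in> E \<Longrightarrow> e \<subseteq> V"
    and edges_nonempty: "e \<in> E \<Longrightarrow> e \<noteq> {}"

definition star :: "'a set set \<Rightarrow> 'a \<Rightarrow> 'a set set" where
  "star E v = {e \<in> E. v \<in> e}"

definition star_rel :: "'a set \<Rightarrow> 'a set set \<Rightarrow> ('a \<times> 'a) set" where
  "star_rel V E = {(u, v) \<in> V \<times> V. star E u = star E v}"

lemma equiv_star_rel: "equiv V (star_rel V E)"
  by (rule equivI) (auto simp: star_rel_def refl_on_def sym_on_def trans_on_def)

definition is_unit_of :: "'a set \<Rightarrow> 'a set set \<Rightarrow> 'a set \<Rightarrow> bool" where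
  "is_unit_of V E U \<longleftrightarrow> U \<in> V // star_rel V E"

text \<open>The complex vector space of all functions \<open>'a \<Rightarrow> complex\<close>, with pointwise
  operations. The space of complex functions on a set \<open>V\<close> is represented by the
  subspace \<open>cfun_on V\<close> of the functions that vanish outside \<open>V\<close>, so that each function
  on \<open>V\<close> has exactly one representative.\<close>

interpretation cfun: vector_space "\<lambda>(c::complex) (x::'a \<Rightarrow> complex) v. c * x v"
  by unfold_locales (auto simp: fun_eq_iff algebra_simps)

definition cfun_on :: "'a set \<Rightarrow> ('a \<Rightarrow> complex) set" where
  "cfun_on V = {x. \<forall>v. v \<notin> V \<longrightarrow> x v = 0}"

lemma subspace_cfun_on: "cfun.subspace (cfun_on V)"
  by (auto simp: cfun.subspace_def cfun_on_def)

definition eigenspace_on ::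
    "'a set \<Rightarrow> (('a \<Rightarrow> complex) \<Rightarrow> ('a \<Rightarrow> complex)) \<Rightarrow> complex \<Rightarrow> ('a \<Rightarrow> complex) set" where
  "eigenspace_on V T \<mu> = {x \<in> cfun_on V. T x = (\<lambda>v. \<mu> * x v)}"

definition signless_laplacian ::
    "'a set \<Rightarrow> 'a set set \<Rightarrow> ('a \<Rightarrow> real) \<Rightarrow> ('a set \<Rightarrow> real) \<Rightarrow> ('a \<Rightarrow> complex) \<Rightarrow> ('a \<Rightarrow> complex)" where
  "signless_laplacian V E \<delta>V \<delta>E x =
    (\<lambda>v. if v \<in> V then
       \<Sum>e\<in>star E v. complex_of_real (\<delta>E e / \<delta>V v * (1 / (real (card e))\<^sup>2)) * (\<Sum>u\<in>e. x u)
     else 0)"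

lemma signless_laplacian_in_cfun_on: "signless_laplacian V E \<delta>V \<delta>E x \<in> cfun_on V"
  by (simp add: signless_laplacian_def cfun_on_def)

definition zero_sum_space :: "'a set \<Rightarrow> 'a set \<Rightarrow> ('a \<Rightarrow> complex) set" where
  "zero_sum_space V U = {x \<in> cfun_on V. {v \<in> V. x v \<noteq> 0} \<subseteq> U \<and> (\<Sum>v\<in>U. x v) = 0}"

definition is_subspace_of :: "('a \<Rightarrow> complex) set \<Rightarrow> ('a \<Rightarrow> complex) set \<Rightarrow> bool" where
  "is_subspace_of S W \<longleftrightarrow> cfun.subspace S \<and> S \<subseteq> W"

end

theory Submission
  imports Defs
begin

text \<open>
  Every value of the signless Laplacian at a vertex is a positive combination of the edge sums
  \<open>\<Sum>u\<in>e. x u\<close> over the edges at that vertex. This makes the condition that a zero-sum space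
  lies in the kernel a purely combinatorial one: all vertices of the set have the same star.

  If all vertices of \<open>W\<close> have the same star, then each edge contains \<open>W\<close> or misses it, so every
  edge sum of a function in the zero-sum space of \<open>W\<close> vanishes
  (\<open>edge_sum_zero_if_same_star\<close>). Conversely, the difference of the indicators of two vertices
  \<open>v\<close> and \<open>u\<close> has edge sum \<open>0\<close> or \<open>-1\<close> on every edge at \<open>u\<close>, and \<open>-1\<close> exactly when the edge
  misses \<open>v\<close>. As there is no cancellation at \<open>u\<close>, membership in the kernel forces every edge at
  \<open>u\<close> to contain \<open>v\<close> (\<open>star_subset_if_in_kernel\<close>).

  Hence a set with zero-sum space in the kernel lies in the unit of any of its vertices. The
  zero-sum space of this unit is also in the kernel, so a maximal such set is the whole unit.
\<close>

lemma subspace_zero_sum_space: "cfun.subspace (zero_sum_space V U)"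
proof (rule cfun.subspaceI)
  show "0 \<in> zero_sum_space V U"
    by (simp add: zero_sum_space_def cfun_on_def)
next
  fix x y assume "x \<in> zero_sum_space V U" "y \<in> zero_sum_space V U"
  then show "x + y \<in> zero_sum_space V U"
    by (fastforce simp: zero_sum_space_def cfun_on_def sum.distrib)
next
  fix c x assume "x \<in> zero_sum_space V U"
  then show "(\<lambda>v. c * x v) \<in> zero_sum_space V U"
    by (auto simp: zero_sum_space_def cfun_on_def sum_distrib_left[symmetric])
qed

lemma edge_sum_zero_if_same_star:
  assumes "finite V" and "e \<in> E" and "e \<subseteq> V"
    and same: "\<And>u v. u \<in> W \<Longrightarrow> v \<in> W \<Longrightarrow> star E u = star E v"
    and x: "x \<in> zero_sum_space V W"
  shows "(\<Sum>u\<in>e. x u) = 0"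
proof (cases "W \<inter> e = {}")
  case True
  then show ?thesis
    using x \<open>e \<subseteq> V\<close> by (intro sum.neutral) (auto simp: zero_sum_space_def)
next
  case False
  then have "W \<subseteq> e"
    using same \<open>e \<in> E\<close> by (auto simp: star_def set_eq_iff)
  have "(\<Sum>u\<in>e. x u) = (\<Sum>u\<in>W. x u)"
    using x \<open>W \<subseteq> e\<close> \<open>e \<subseteq> V\<close> finite_subset[OF \<open>e \<subseteq> V\<close> \<open>finite V\<close>]
    by (intro sum.mono_neutral_right) (auto simp: zero_sum_space_def)
  also have "\<dots> = 0"
    using x by (simp add: zero_sum_space_def)
  finally show ?thesis .
qed

lemma zero_sum_space_in_kernel_if_same_star:
  assumes H: "finite_hypergraph V E"
    and same: "\<And>u v. u \<in> W \<Longrightarrow> v \<in> W \<Longrightarrow> star E u = star E v"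
  shows "zero_sum_space V W \<subseteq> eigenspace_on V (signless_laplacian V E \<delta>V \<delta>E) 0"
proof
  fix x assume x: "x \<in> zero_sum_space V W"
  have "(\<Sum>u\<in>e. x u) = 0" if "e \<in> E" for e
    using H that by (intro edge_sum_zero_if_same_star[OF _ that _ same x])
      (auto simp: finite_hypergraph_def)
  then show "x \<in> eigenspace_on V (signless_laplacian V E \<delta>V \<delta>E) 0"
    using x by (auto simp: eigenspace_on_def signless_laplacian_def zero_sum_space_def
        star_def fun_eq_iff intro!: sum.neutral)
qed

definition indicator_diff :: "'a \<Rightarrow> 'a \<Rightarrow> 'a \<Rightarrow> complex" where
  "indicator_diff v u w = of_bool (w = v) - of_bool (w = u)"

lemma sum_indicator_diff:
  assumes "finite A"
  shows "(\<Sum>w\<in>A. indicator_diff v u w) = of_bool (v \<in> A) - of_bool (u \<in> A)"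
  using assms by (simp add: indicator_diff_def sum_subtractf of_bool_def)

lemma indicator_diff_in_zero_sum_space:
  assumes "finite V" "U \<subseteq> V" "u \<in> U" "v \<in> U"
  shows "indicator_diff v u \<in> zero_sum_space V U"
proof -
  have "(\<Sum>w\<in>U. indicator_diff v u w) = 0"
    using assms finite_subset[of U V] by (simp add: sum_indicator_diff)
  moreover have "indicator_diff v u w = 0" if "w \<notin> U" for w
    using assms that by (auto simp: indicator_diff_def)
  ultimately show ?thesis
    using assms by (auto simp: zero_sum_space_def cfun_on_def)
qed

text \<open>The value at \<open>u\<close> is minus the sum of the positive weights of the edges at \<open>u\<close> that miss
  \<open>v\<close>, so it vanishes only if there is no such edge.\<close>

lemma star_subset_if_in_kernel:
  assumes H: "finite_hypergraph V E"
    and "\<delta>V u > 0" and \<delta>E: "\<And>e. e \<in> E \<Longrightarrow> \<delta>E e > 0"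
    and "u \<in> V"
    and ker: "signless_laplacian V E \<delta>V \<delta>E (indicator_diff v u) u = 0"
  shows "star E u \<subseteq> star E v"
proof
  fix e assume e: "e \<in> star E u"
  define c where "c e = \<delta>E e / \<delta>V u * (1 / (real (card e))\<^sup>2)" for e
  have finE: "finite f" and c_pos: "c f > 0" if "f \<in> E" for f
  proof -
    show "finite f"
      using H that by (meson finite_hypergraph_def finite_subset)
    then have "card f > 0"
      using H that by (auto simp: finite_hypergraph_def card_gt_0_iff)
    then show "c f > 0"
      using \<delta>E[OF that] \<open>\<delta>V u > 0\<close> by (simp add: c_def)
  qed
  have "E \<subseteq> Pow V" "finite V"
    using H by (auto simp: finite_hypergraph_def)
  then have "finite (star E u)"
    by (auto simp: star_def intro: finite_subset)
  have "complex_of_real (\<Sum>f\<in>star E u. c f * of_bool (v \<notin> f)) =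
      - (\<Sum>f\<in>star E u. complex_of_real (c f) * (\<Sum>w\<in>f. indicator_diff v u w))"
    unfolding of_real_sum sum_negf[symmetric]
    by (intro sum.cong) (auto simp: star_def sum_indicator_diff finE)
  also have "\<dots> = - signless_laplacian V E \<delta>V \<delta>E (indicator_diff v u) u"
    using \<open>u \<in> V\<close> by (simp add: signless_laplacian_def c_def)
  finally have "(\<Sum>f\<in>star E u. c f * of_bool (v \<notin> f)) = 0"
    using ker by (simp only: minus_zero of_real_eq_0_iff)
  then have "c e * of_bool (v \<notin> e) = 0"
    using e c_pos \<open>finite (star E u)\<close>
    by (subst (asm) sum_nonneg_eq_0_iff) (auto simp: star_def less_imp_le)
  then show "e \<in> star E v"
    using e c_pos[of e] by (auto simp: star_def split: if_splits)
qed

lemma same_star_if_zero_sum_space_in_kernel: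
  assumes H: "finite_hypergraph V E"
    and \<delta>V: "\<And>v. v \<in> V \<Longrightarrow> \<delta>V v > 0" and \<delta>E: "\<And>e. e \<in> E \<Longrightarrow> \<delta>E e > 0"
    and "U \<subseteq> V"
    and ker: "zero_sum_space V U \<subseteq> eigenspace_on V (signless_laplacian V E \<delta>V \<delta>E) 0"
    and "u \<in> U" "v \<in> U"
  shows "star E u = star E v"
proof -
  have "star E a \<subseteq> star E b" if "a \<in> U" "b \<in> U" for a b
  proof (rule star_subset_if_in_kernel[OF H _ \<delta>E])
    show "a \<in> V" "\<delta>V a > 0"
      using that \<open>U \<subseteq> V\<close> \<delta>V by auto
    have "indicator_diff b a \<in> eigenspace_on V (signless_laplacian V E \<delta>V \<delta>E) 0"
      using ker indicator_diff_in_zero_sum_space[OF _ \<open>U \<subseteq> V\<close> that] H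
      by (auto simp: finite_hypergraph_def)
    then show "signless_laplacian V E \<delta>V \<delta>E (indicator_diff b a) a = 0"
      by (simp add: eigenspace_on_def)
  qed
  then show ?thesis
    using \<open>u \<in> U\<close> \<open>v \<in> U\<close> by blast
qed

theorem theorem3p6:
  fixes V :: "'a set" and E :: "'a set set"
    and \<delta>V :: "'a \<Rightarrow> real" and \<delta>E :: "'a set \<Rightarrow> real"
    and U :: "'a set"
  assumes "finite_hypergraph V E"
    and "\<And>v. v \<in> V \<Longrightarrow> \<delta>V v > 0"
    and "\<And>e. e \<in> E \<Longrightarrow> \<delta>E e > 0"
    and "U \<subseteq> V"
    and "card U > 1"
    and "is_subspace_of (zero_sum_space V U)
           (eigenspace_on V (signless_laplacian V E \<delta>V \<delta>E) 0)"
    and "\<And>W. U \<subseteq> W \<Longrightarrow> W \<subseteq> V \<Longrightarrow>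
           is_subspace_of (zero_sum_space V W)
             (eigenspace_on V (signless_laplacian V E \<delta>V \<delta>E) 0) \<Longrightarrow> W = U"
  shows "is_unit_of V E U"
proof -
  from \<open>card U > 1\<close> obtain u where "u \<in> U"
    by fastforce
  then have "u \<in> V"
    using \<open>U \<subseteq> V\<close> by blast
  define W where "W = star_rel V E `` {u}"
  have "star E u = star E v" if "v \<in> U" for v
    using assms(6) \<open>u \<in> U\<close> that
    by (intro same_star_if_zero_sum_space_in_kernel[OF assms(1-4)]) (auto simp: is_subspace_of_def)
  then have "U \<subseteq> W"
    using \<open>u \<in> V\<close> \<open>U \<subseteq> V\<close> by (auto simp: W_def star_rel_def)
  have "W \<subseteq> V"
    by (auto simp: W_def star_rel_def)
  have "zero_sum_space V W \<subseteq> eigenspace_on V (signless_laplacian V E \<delta>V \<delta>E) 0"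
    by (rule zero_sum_space_in_kernel_if_same_star[OF assms(1)]) (auto simp: W_def star_rel_def)
  then have "W = U"
    using assms(7)[OF \<open>U \<subseteq> W\<close> \<open>W \<subseteq> V\<close>] subspace_zero_sum_space
    by (auto simp: is_subspace_of_def)
  moreover have "W \<in> V // star_rel V E"
    unfolding W_def using \<open>u \<in> V\<close> by (rule quotientI)
  ultimately show ?thesis
    by (simp add: is_unit_of_def)
qed

end
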